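(* Let $E$ be a bounded open set of $\mathbb{R}^d$. The map that sends a nonempty compact subset $K$ of $\mathbb{R}^d$ to its projection function $p_K\in L^1(E)$ is locally $h$-Hölder for every exponent $0<h<\frac{1}{4d-2}$, where the set of compact subsets is equipped with the Hausdorff distance. That is, for every such $h$ and every nonempty compact $K_0\subseteq\mathbb{R}^d$ there exist $r>0$ and $C\ge 0$ such that $\|p_K-p_{K'}\|_{L^1(E)}\le C\, d_H(K,K')^h$ for all nonempty compact sets $K,K'$ with $d_H(K,K_0)\le r$ and $d_H(K',K_0)\le r$.
   Context: For a nonempty compact set $K\subseteq\mathbb{R}^d$, $d_K(x)=\min_{p\in K}\|p-x\|$. The medial axis $\mathrm{Med}(K)$ is the set of points $x\in\mathbb{R}^d$ having more than one nearest point in $K$; it has Lebesgue measure zero. For $x\notin\mathrm{Med}(K)$, $p_K(x)$ is the unique nearest point of $x$ in $K$; this defines the projection function $p_K:\mathbb{R}^d\setminus\mathrm{Med}(K)\to K\subseteq\mathbb{R}^d$, defined almost everywhere. $\|p_K-p_{K'}\|_{L^1(E)}=\int_E\|p_K(x)-p_{K'}(x)\|\,dx$ (Lebesgue measure). The Hausdorff distance is $d_H(K,K')=\sup_{x\in\mathbb{R}^d}|d_K(x)-d_{K'}(x)|$. *)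

theory Defs
  imports "HOL-Analysis.Analysis"
begin

definition nearest_points :: "'a::metric_space set \<Rightarrow> 'a \<Rightarrow> 'a set" where
  "nearest_points K x = {p \<in> K. dist x p = infdist x K}"

definition medial_axis :: "'a::metric_space set \<Rightarrow> 'a set" where
  "medial_axis K = {x. \<exists>p \<in> nearest_points K x. \<exists>q \<in> nearest_points K x. p \<noteq> q}"

text \<open>
  For nonempty compact \<open>K\<close>, the projection is defined only off the medial axis, which is a
  Lebesgue null set. The value 0 on the medial axis makes the function total; it does not
  affect the class of the function in \<open>L\<^sup>1\<close>.
\<close>

definition proj_fun :: "'a::euclidean_space set \<Rightarrow> 'a \<Rightarrow> 'a" where
  "proj_fun K x = (if x \<in> medial_axis K then 0 else closest_point K x)"

text \<open>
  The supremum below is over a bounded set when \<open>K\<close> and \<open>K'\<close> are nonempty and bounded,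
  hence it is a genuine one for nonempty compact sets.
\<close>

definition hausdorff_distance :: "'a::metric_space set \<Rightarrow> 'a set \<Rightarrow> real" where
  "hausdorff_distance K K' = (SUP x. \<bar>infdist x K - infdist x K'\<bar>)"

definition L1_norm_on :: "'a::euclidean_space set \<Rightarrow> ('a \<Rightarrow> 'b::real_normed_vector) \<Rightarrow> real" where
  "L1_norm_on E f = (LINT x:E|lebesgue. norm (f x))"

end

theory Submission
  imports Defs
begin

text \<open>
The function \<open>f\<^sub>K(x) = (\<parallel>x\<parallel>\<^sup>2 - d\<^sub>K(x)\<^sup>2) / 2\<close> is a supremum of affine functions \<open>x \<bullet> p - \<parallel>p\<parallel>\<^sup>2 / 2\<close> over \<open>p \<in> K\<close>,
hence convex, and a nearest point of \<open>x\<close> in \<open>K\<close> is a subgradient of \<open>f\<^sub>K\<close> at \<open>x\<close>. If the Hausdorff distance of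
\<open>K\<close> and \<open>K'\<close> is \<open>\<delta>\<close>, then \<open>f\<^sub>K\<close> and \<open>f\<^sub>K\<^sub>'\<close> differ by \<open>O(\<delta>)\<close> on bounded sets. The theorem is thus a case of the
stability of gradients of convex functions in \<open>L\<^sup>1\<close>, and holds even with the exponent 1/2, which is at
least \<open>1 / (4 d - 2)\<close> in every dimension \<open>d \<ge> 1\<close>.

Fix a coordinate direction \<open>b\<close> and a step \<open>s\<close>. Convexity bounds the difference of the \<open>b\<close>-coordinates of
the two projections at \<open>x\<close> by the sum of their increments from \<open>x\<close> to \<open>x + s b\<close>, plus an error \<open>O(\<delta> / s)\<close>
(\<open>closest_point_component_diff_le\<close>). Increments of a bounded function, integrated against a Lipschitz
cutoff, give only \<open>O(s)\<close>, because a translation moves the increment to the cutoff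
(\<open>integral_tent_increment_le\<close>). Altogether the \<open>L\<^sup>1\<close> distance is \<open>O(s + \<delta> / s)\<close>, and \<open>s = sqrt \<delta>\<close> gives
\<open>O(sqrt \<delta>)\<close> (\<open>L1_norm_on_proj_fun_diff_le_sqrt\<close>).

The same monotonicity of nearest points along lines shows that the medial axis is a null set
(\<open>negligible_medial_axis\<close>), so that the projection may be replaced by any choice of nearest points.
\<close>

section \<open>Monotonicity of nearest points\<close>

lemma closest_point_in_nearest_points:
  assumes "compact K" "K \<noteq> {}"
  shows "closest_point K x \<in> nearest_points K x"
proof -
  obtain z where z: "z \<in> K" "infdist x K = dist x z"
    using infdist_attains_inf[of K x] assms compact_imp_closed by blast
  have c: "closest_point K x \<in> K"
    using closest_point_in_set assms compact_imp_closed by blast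
  have "dist x (closest_point K x) \<le> dist x z"
    using closest_point_exists(2)[of K x] assms compact_imp_closed z(1) by blast
  with z(2) infdist_le[OF c, of x] c show ?thesis
    by (simp add: nearest_points_def)
qed

text \<open>
Testing the distance of \<open>y\<close> to \<open>K\<close> with \<open>p\<close>, and that of \<open>x\<close> to \<open>K'\<close> with \<open>r\<close>, and expanding the
squares. In terms of the convex function \<open>(\<parallel>x\<parallel>\<^sup>2 - d\<^sub>K(x)\<^sup>2) / 2\<close>, this adds the subgradient inequality
for \<open>K\<close> at \<open>x\<close> to the one for \<open>K'\<close> at \<open>y\<close>. The right-hand side vanishes when \<open>K = K'\<close>, and is small when
the two distance functions are close.
\<close>

lemma nearest_points_inner_le:
  fixes K K' :: "'a::euclidean_space set"
  assumes p: "p \<in> nearest_points K x" and r: "r \<in> nearest_points K' y"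
  shows "2 * ((p - r) \<bullet> (y - x)) \<le> ((infdist x K)\<^sup>2 - (infdist x K')\<^sup>2) + ((infdist y K')\<^sup>2 - (infdist y K)\<^sup>2)"
proof -
  have "infdist y K \<le> dist y p" "infdist x K' \<le> dist x r"
    using p r by (auto simp: nearest_points_def intro: infdist_le)
  then have "(infdist y K)\<^sup>2 \<le> (dist y p)\<^sup>2" "(infdist x K')\<^sup>2 \<le> (dist x r)\<^sup>2"
    by (auto intro: power_mono simp: infdist_nonneg)
  moreover have "infdist x K = dist x p" "infdist y K' = dist y r"
    using p r by (auto simp: nearest_points_def)
  ultimately show ?thesis
    by (simp add: dist_norm power2_norm_eq_inner inner_diff inner_commute algebra_simps)
qed

lemma nearest_points_monotone:
  fixes K :: "'a::euclidean_space set"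
  assumes "p \<in> nearest_points K x" "r \<in> nearest_points K y"
  shows "0 \<le> (r - p) \<bullet> (y - x)"
  using nearest_points_inner_le[OF assms] by (simp add: inner_diff)

section \<open>The medial axis is a null set\<close>

text \<open>
Some nearest point lies in \<open>C\<close> exactly when cutting \<open>K\<close> down to \<open>C\<close> does not increase the distance, and
this compares two continuous functions.
\<close>

lemma closed_nearest_points_meet:
  fixes K C :: "'a::euclidean_space set"
  assumes "compact K" "closed C"
  shows "closed {x. nearest_points K x \<inter> C \<noteq> {}}"
proof (cases "K \<inter> C = {}")
  case True
  then have "{x. nearest_points K x \<inter> C \<noteq> {}} = {}"
    by (auto simp: nearest_points_def)
  then show ?thesis by simp
next
  case False
  have "nearest_points K x \<inter> C \<noteq> {} \<longleftrightarrow> infdist x (K \<inter> C) \<le> infdist x K" for x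
  proof
    assume "nearest_points K x \<inter> C \<noteq> {}"
    then show "infdist x (K \<inter> C) \<le> infdist x K"
      by (force simp: nearest_points_def intro: infdist_le2)
  next
    assume le: "infdist x (K \<inter> C) \<le> infdist x K"
    have "closed (K \<inter> C)"
      using assms compact_imp_closed by blast
    then obtain z where z: "z \<in> K \<inter> C" "infdist x (K \<inter> C) = dist x z"
      using infdist_attains_inf[of "K \<inter> C" x] False by blast
    have "infdist x K \<le> dist x z"
      using z by (auto intro: infdist_le)
    then show "nearest_points K x \<inter> C \<noteq> {}"
      using z le by (auto simp: nearest_points_def)
  qed
  then show ?thesis
    by (simp add: closed_Collect_le continuous_on_infdist)
qed

text \<open>
Inside a box, the set has arbitrarily many pairwise disjoint translates of equal measure, by multiples
\<open>k / N\<close> of \<open>b\<close> with \<open>k < N\<close>; all of them stay in one ball, whose measure is finite.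
\<close>

lemma negligible_if_translates_disjoint:
  fixes S :: "'a::euclidean_space set"
  assumes S: "closed S" and disj: "\<And>x t. x \<in> S \<Longrightarrow> 0 < t \<Longrightarrow> x + t *\<^sub>R b \<notin> S"
  shows "negligible S"
  unfolding negligible_on_intervals[of S]
proof (intro allI)
  fix u v :: 'a
  let ?T = "S \<inter> cbox u v"
  have T: "?T \<in> lmeasurable"
    using S by (intro lmeasurable_compact) (auto intro: closed_Int_compact)
  obtain R where R: "\<And>x. x \<in> cbox u v \<Longrightarrow> norm x \<le> R"
    using bounded_cbox[of u v] unfolding bounded_iff by blast
  let ?V = "measure lebesgue (cball (0::'a) (R + norm b))"
  have N: "real N * measure lebesgue ?T \<le> ?V" for N :: nat
  proof -
    let ?F = "\<lambda>k::nat. (+) ((real k / real N) *\<^sub>R b) ` ?T"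
    have F: "?F k \<in> lmeasurable" for k
      using T by (rule measurable_translation)
    have "pairwise (\<lambda>j k. disjnt (?F j) (?F k)) {..<N}"
    proof -
      have "?F j \<inter> ?F k = {}" if "j < k" "k < N" for j k
      proof (rule ccontr)
        assume "?F j \<inter> ?F k \<noteq> {}"
        then obtain x y where xy: "x \<in> S" "y \<in> S" and "(real j / real N) *\<^sub>R b + x = (real k / real N) *\<^sub>R b + y"
          by blast
        then have "x = y + (real k / real N - real j / real N) *\<^sub>R b"
          by (simp add: algebra_simps)
        moreover have "0 < real k / real N - real j / real N"
          using that by (simp add: field_simps)
        ultimately show False
          using disj xy by blast
      qed
      then show ?thesis
        unfolding pairwise_def disjnt_def by (metis Int_commute lessThan_iff linorder_neqE_nat)
    qed
    then have "measure lebesgue (\<Union>k<N. ?F k) = (\<Sum>k<N. measure lebesgue (?F k))"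
      using F by (intro measure_UNION') auto
    also have "\<dots> = real N * measure lebesgue ?T"
      by (simp add: measure_translation)
    finally have "real N * measure lebesgue ?T = measure lebesgue (\<Union>k<N. ?F k)" ..
    also have "\<dots> \<le> ?V"
    proof (rule measure_mono_fmeasurable)
      show "(\<Union>k<N. ?F k) \<subseteq> cball 0 (R + norm b)"
      proof clarsimp
        fix k x assume "k < N" "x \<in> cbox u v"
        then have "norm ((real k / real N) *\<^sub>R b) \<le> norm b" "norm x \<le> R"
          using R by (auto simp: field_simps mult_right_mono)
        then show "norm ((real k / real N) *\<^sub>R b + x) \<le> R + norm b"
          using norm_triangle_ineq[of "(real k / real N) *\<^sub>R b" x] by linarith
      qed
    qed (use F in auto)
    finally show ?thesis .
  qed
  have "measure lebesgue ?T = 0"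
  proof (rule ccontr)
    assume "measure lebesgue ?T \<noteq> 0"
    then have "0 < measure lebesgue ?T" by (simp add: zero_less_measure_iff)
    then obtain N :: nat where "?V < real N * measure lebesgue ?T"
      using reals_Archimedean3 by blast
    with N[of N] show False by simp
  qed
  with T show "negligible ?T" by (simp add: negligible_iff_measure)
qed

text \<open>
If \<open>x\<close> has two nearest points, two rationals \<open>c < c'\<close> separate them in some coordinate. For fixed
\<open>b\<close>, \<open>c\<close>, \<open>c'\<close> the set of such \<open>x\<close> meets no line of direction \<open>b\<close> twice: along such a line the \<open>b\<close>-coordinate
of a nearest point never decreases, so past a point where it can be \<open>\<ge> c'\<close> it cannot be \<open>\<le> c\<close>.
\<close>

lemma negligible_medial_axis:
  fixes K :: "'a::euclidean_space set"
  assumes "compact K"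
  shows "negligible (medial_axis K)"
proof -
  let ?A = "\<lambda>b c c'. {x. nearest_points K x \<inter> {p. p \<bullet> b \<le> c} \<noteq> {}} \<inter> {x. nearest_points K x \<inter> {p. c' \<le> p \<bullet> b} \<noteq> {}}"
  have neg: "negligible (?A b c c')" if b: "b \<in> Basis" and "c < c'" for b and c c' :: real
  proof (rule negligible_if_translates_disjoint[where b = b])
    show "closed (?A b c c')"
      using assms by (intro closed_Int closed_nearest_points_meet closed_Collect_le continuous_intros)
    fix x t assume "x \<in> ?A b c c'" and t: "0 < (t::real)"
    then obtain q where q: "q \<in> nearest_points K x" "c' \<le> q \<bullet> b" by blast
    show "x + t *\<^sub>R b \<notin> ?A b c c'"
    proof
      assume "x + t *\<^sub>R b \<in> ?A b c c'"
      then obtain p where p: "p \<in> nearest_points K (x + t *\<^sub>R b)" "p \<bullet> b \<le> c" by blast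
      have "0 \<le> t * ((p - q) \<bullet> b)"
        using nearest_points_monotone[OF q(1) p(1)] by simp
      then have "q \<bullet> b \<le> p \<bullet> b"
        using t by (simp add: inner_diff zero_le_mult_iff)
      with p q \<open>c < c'\<close> show False by linarith
    qed
  qed
  let ?I = "{(b, c, c'). b \<in> Basis \<and> c \<in> \<rat> \<and> c' \<in> \<rat> \<and> c < c'} :: ('a \<times> real \<times> real) set"
  have "countable ((Basis :: 'a set) \<times> (\<rat> :: real set) \<times> (\<rat> :: real set))"
    by (intro countable_SIGMA countable_rat countable_finite finite_Basis)
  then have "countable ?I"
    by (rule countable_subset[rotated]) auto
  then have "negligible (\<Union>(b, c, c')\<in>?I. ?A b c c')"
    using neg by (intro negligible_countable_Union) auto
  moreover have "medial_axis K \<subseteq> (\<Union>(b, c, c')\<in>?I. ?A b c c')"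
  proof
    fix x assume "x \<in> medial_axis K"
    then obtain p q where pq: "p \<in> nearest_points K x" "q \<in> nearest_points K x" "p \<noteq> q"
      unfolding medial_axis_def by blast
    then obtain b where b: "b \<in> Basis" "p \<bullet> b \<noteq> q \<bullet> b"
      using euclidean_eqI by blast
    have "\<exists>p\<in>nearest_points K x. \<exists>q\<in>nearest_points K x. p \<bullet> b < q \<bullet> b"
      using pq b by (meson linorder_neqE_linordered_idom)
    then obtain p q where pq: "p \<in> nearest_points K x" "q \<in> nearest_points K x" "p \<bullet> b < q \<bullet> b"
      by blast
    obtain c where c: "c \<in> \<rat>" "p \<bullet> b < c" "c < q \<bullet> b"
      using Rats_dense_in_real pq by blast
    obtain c' where c': "c' \<in> \<rat>" "c < c'" "c' < q \<bullet> b"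
      using Rats_dense_in_real c by blast
    have "x \<in> ?A b c c'"
      using pq c c' by fastforce
    with b c c' show "x \<in> (\<Union>(b, c, c')\<in>?I. ?A b c c')"
      by blast
  qed
  ultimately show ?thesis
    by (rule negligible_subset)
qed

section \<open>Measurability and integrability of the projection\<close>

lemma AE_notin_medial_axis:
  fixes K :: "'a::euclidean_space set"
  assumes "compact K"
  shows "AE x in lebesgue. x \<notin> medial_axis K"
proof -
  have "medial_axis K \<in> null_sets lebesgue"
    using negligible_medial_axis[OF assms] by (simp add: negligible_iff_null_sets)
  then show ?thesis
    by (rule AE_not_in)
qed

text \<open>
On the medial axis, \<open>closest_point\<close> is an arbitrary choice. Off this null set, its superlevel sets in each
coordinate agree with the closed sets of points having a nearest point in a half-space, and Lebesgue
measure is complete.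
\<close>

lemma closest_point_measurable:
  fixes K :: "'a::euclidean_space set"
  assumes "compact K" "K \<noteq> {}"
  shows "closest_point K \<in> borel_measurable lebesgue"
  unfolding borel_measurable_iff_halfspace_ge
proof (intro ballI allI)
  fix b :: 'a and c :: real
  let ?F = "{x. nearest_points K x \<inter> {p. c \<le> p \<bullet> b} \<noteq> {}}"
  let ?S = "{x. c \<le> closest_point K x \<bullet> b}"
  have cp: "closest_point K x \<in> nearest_points K x" for x
    using closest_point_in_nearest_points assms by blast
  have "closed ?F"
    using assms by (intro closed_nearest_points_meet closed_Collect_le continuous_intros)
  then have "?F \<in> sets lebesgue"
    by (intro sets_completionI_sets) auto
  moreover have "AE x in lebesgue. x \<in> ?F \<longleftrightarrow> x \<in> ?S"
    using AE_notin_medial_axis[OF assms(1)]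
  proof eventually_elim
    case (elim x)
    then show ?case
      using cp[of x] by (fastforce simp: medial_axis_def)
  qed
  ultimately show "{x \<in> space lebesgue. c \<le> closest_point K x \<bullet> b} \<in> sets lebesgue"
    using completion.in_sets_AE[of ?F ?S lborel] by simp
qed

lemma AE_proj_fun_eq_closest_point:
  fixes K :: "'a::euclidean_space set"
  assumes "compact K"
  shows "AE x in lebesgue. proj_fun K x = closest_point K x"
  using AE_notin_medial_axis[OF assms] by eventually_elim (simp add: proj_fun_def)

lemma proj_fun_measurable:
  fixes K :: "'a::euclidean_space set"
  assumes "compact K" "K \<noteq> {}"
  shows "proj_fun K \<in> borel_measurable lebesgue"
proof (rule borel_measurable_AE)
  show "closest_point K \<in> borel_measurable lebesgue"
    using assms by (rule closest_point_measurable)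
  show "AE x in lebesgue. closest_point K x = proj_fun K x"
    using AE_proj_fun_eq_closest_point[OF assms(1)] by eventually_elim simp
qed

lemma norm_closest_point_le:
  assumes "compact K" "K \<noteq> {}" "K \<subseteq> cball 0 B"
  shows "norm (closest_point K x) \<le> B"
  using closest_point_in_nearest_points[OF assms(1,2), of x] assms(3)
  by (auto simp: nearest_points_def)

lemma proj_fun_absolutely_integrable:
  fixes K :: "'a::euclidean_space set"
  assumes "open E" "bounded E" "compact K" "K \<noteq> {}"
  shows "proj_fun K absolutely_integrable_on E"
proof -
  obtain B where B: "K \<subseteq> cball 0 B" "0 \<le> B"
    using bounded_subset_ballD[OF compact_imp_bounded[OF assms(3)], of 0] ball_subset_cball
    by (meson less_imp_le subset_trans)
  have nb: "norm (proj_fun K x) \<le> B" for x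
    using norm_closest_point_le[OF assms(3,4) B(1), of x] B(2) by (simp add: proj_fun_def)
  have E: "E \<in> lmeasurable"
    using assms lmeasurable_open by blast
  show ?thesis
    unfolding set_integrable_def
    by (rule integrableI_bounded_set_indicator[where B = B])
      (use E nb proj_fun_measurable[OF assms(3,4)] in \<open>auto simp: fmeasurable_def\<close>)
qed

section \<open>Increments integrated against a cutoff\<close>

text \<open>
Since nearest points are chosen arbitrarily on a null set, measurability refers to the completed measure,
and so must translation invariance.
\<close>

lemma
  fixes f :: "'a::euclidean_space \<Rightarrow> 'b::euclidean_space" and v :: 'a
  assumes [measurable]: "f \<in> borel_measurable lebesgue"
  shows lebesgue_measurable_translate: "(\<lambda>x. f (x + v)) \<in> borel_measurable lebesgue"
    and lebesgue_integral_translate: "(\<integral>x. f (x + v) \<partial>lebesgue) = (\<integral>x. f x \<partial>lebesgue)"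
proof -
  have T: "(\<lambda>x. v + (\<Sum>j\<in>Basis. (1 * (x \<bullet> j)) *\<^sub>R j)) = (\<lambda>x. x + v)"
    by (simp add: euclidean_representation add.commute)
  have [measurable]: "(\<lambda>x. x + v) \<in> lebesgue \<rightarrow>\<^sub>M lebesgue"
    using lebesgue_affine_measurable[of "\<lambda>_. 1" v] unfolding T by simp
  show "(\<lambda>x. f (x + v)) \<in> borel_measurable lebesgue"
    by measurable
  have "lebesgue = distr lebesgue lebesgue (\<lambda>x. x + v)"
    using lebesgue_affine_euclidean[of "\<lambda>_. 1" v] unfolding T by (simp add: density_1)
  then have "(\<integral>x. f x \<partial>lebesgue) = (\<integral>x. f x \<partial>distr lebesgue lebesgue (\<lambda>x. x + v))"
    by simp
  also have "\<dots> = (\<integral>x. f (x + v) \<partial>lebesgue)"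
    by (rule integral_distr) measurable
  finally show "(\<integral>x. f (x + v) \<partial>lebesgue) = (\<integral>x. f x \<partial>lebesgue)" ..
qed

lemma integrable_bounded_support:
  fixes f :: "'a::euclidean_space \<Rightarrow> 'b::euclidean_space"
  assumes "f \<in> borel_measurable lebesgue" "\<And>x. norm x \<le> R \<Longrightarrow> norm (f x) \<le> M" "\<And>x. R < norm x \<Longrightarrow> f x = 0"
  shows "integrable lebesgue f"
proof (rule integrableI_bounded_set[where A = "cball 0 R" and B = M])
  show "emeasure lebesgue (cball (0::'a) R) < \<infinity>"
    using lmeasurable_cball[of "0::'a" R] by (simp add: fmeasurable_def)
qed (use assms in auto)

text \<open>
The cutoff that replaces the indicator function of a set inside the ball of radius \<open>R\<close>. Being Lipschitz, it
is changed by a translation only in proportion to the length of the translation.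
\<close>

definition tent :: "real \<Rightarrow> 'a::real_normed_vector \<Rightarrow> real" where
  "tent R x = max 0 (R + 1 - norm x)"

lemma tent_nonneg: "0 \<le> tent R x"
  by (simp add: tent_def)

lemma tent_eq_0: "R + 1 \<le> norm x \<Longrightarrow> tent R x = 0"
  by (simp add: tent_def)

lemma tent_ge_1: "norm x \<le> R \<Longrightarrow> 1 \<le> tent R x"
  by (simp add: tent_def)

lemma tent_le: "0 \<le> R \<Longrightarrow> tent R x \<le> R + 1"
  by (simp add: tent_def)

lemma tent_lipschitz: "\<bar>tent R x - tent R y\<bar> \<le> norm (x - y)"
proof -
  have "\<bar>norm x - norm y\<bar> \<le> norm (x - y)" by (rule norm_triangle_ineq3)
  then show ?thesis by (auto simp: tent_def max_def)
qed

lemma tent_measurable [measurable]: "tent R \<in> borel_measurable (lebesgue :: 'a::euclidean_space measure)"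
proof -
  have "continuous_on UNIV (tent R :: 'a \<Rightarrow> real)"
    unfolding tent_def[abs_def] by (intro continuous_intros)
  then show ?thesis
    by (intro measurable_completion) (simp add: borel_measurable_continuous_onI)
qed

lemma integral_tent_le:
  assumes R: "0 \<le> R"
  shows "integrable lebesgue (tent R :: 'a::euclidean_space \<Rightarrow> real)"
    and "integral\<^sup>L lebesgue (tent R :: 'a \<Rightarrow> real) \<le> (R + 1) * measure lebesgue (cball (0::'a) (R + 2))"
proof -
  show i: "integrable lebesgue (tent R :: 'a \<Rightarrow> real)"
    by (rule integrable_bounded_support[where R = "R + 1" and M = "R + 1"])
      (measurable, use R in \<open>auto simp: tent_eq_0 tent_nonneg tent_le\<close>)
  have "integral\<^sup>L lebesgue (tent R :: 'a \<Rightarrow> real) \<le> (\<integral>x. (R + 1) * indicat_real (cball 0 (R + 2)) (x::'a) \<partial>lebesgue)"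
  proof (rule integral_mono[OF i])
    show "integrable lebesgue (\<lambda>x::'a. (R + 1) * indicat_real (cball 0 (R + 2)) x)"
      using lmeasurable_cball[of "0::'a" "R + 2"] by (intro integrable_mult_right) (simp add: fmeasurable_def)
    fix x :: 'a
    show "tent R x \<le> (R + 1) * indicat_real (cball 0 (R + 2)) x"
      using tent_le[OF R, of x] tent_eq_0[of R x] by (auto simp: indicator_def)
  qed
  then show "integral\<^sup>L lebesgue (tent R :: 'a \<Rightarrow> real) \<le> (R + 1) * measure lebesgue (cball (0::'a) (R + 2))"
    by simp
qed

text \<open>
A discrete integration by parts: translation moves the increment from \<open>f\<close> to the cutoff, which changes by
at most \<open>norm v\<close>. The one-sided bound is what is wanted, since it will be applied to increments of
coordinates of nearest points, which are nonnegative.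
\<close>

lemma integral_tent_increment_le:
  fixes f :: "'a::euclidean_space \<Rightarrow> real"
  assumes f: "f \<in> borel_measurable lebesgue" and B: "\<And>x. \<bar>f x\<bar> \<le> B" and R: "0 \<le> R" and v: "norm v \<le> 1"
  shows "integrable lebesgue (\<lambda>x. tent R x * (f (x + v) - f x))"
    and "(\<integral>x. tent R x * (f (x + v) - f x) \<partial>lebesgue) \<le> B * norm v * measure lebesgue (cball (0::'a) (R + 2))"
proof -
  note [measurable] = f lebesgue_measurable_translate[OF f]
  have "0 \<le> B" using B[of 0] by linarith
  have m1: "\<bar>tent R y * f x\<bar> \<le> (R + 1) * B" for x y
    unfolding abs_mult using tent_le[OF R, of y] tent_nonneg[of R y] B[of x] R by (intro mult_mono) auto
  have i1: "integrable lebesgue (\<lambda>x. tent R x * f (x + v))"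
    by (rule integrable_bounded_support[where R = "R + 1" and M = "(R + 1) * B"])
      (measurable, use m1 in \<open>auto simp: tent_eq_0\<close>)
  have i2: "integrable lebesgue (\<lambda>x. tent R x * f x)"
    by (rule integrable_bounded_support[where R = "R + 1" and M = "(R + 1) * B"])
      (measurable, use m1 in \<open>auto simp: tent_eq_0\<close>)
  have t3: "(\<lambda>x. tent R (x - v)) \<in> borel_measurable lebesgue"
    using lebesgue_measurable_translate[OF tent_measurable, of R "- v"] by simp
  have off: "tent R (x - v) = 0" "tent R x = 0" if "R + 2 < norm x" for x
  proof -
    have "norm x \<le> norm (x - v) + norm v"
      by (metis diff_add_cancel norm_triangle_ineq)
    then show "tent R (x - v) = 0" "tent R x = 0"
      using that v by (auto intro!: tent_eq_0)
  qed
  have i3: "integrable lebesgue (\<lambda>x. tent R (x - v) * f x)"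
    by (rule integrable_bounded_support[where R = "R + 2" and M = "(R + 1) * B"])
      (use t3 f m1 in \<open>auto simp: off\<close>)
  have "integrable lebesgue (\<lambda>x. tent R x * f (x + v) - tent R x * f x)"
    using i1 i2 by (rule Bochner_Integration.integrable_diff)
  then show "integrable lebesgue (\<lambda>x. tent R x * (f (x + v) - f x))"
    by (simp add: right_diff_distrib)
  have "(\<integral>x. tent R x * (f (x + v) - f x) \<partial>lebesgue)
      = (\<integral>x. tent R x * f (x + v) \<partial>lebesgue) - (\<integral>x. tent R x * f x \<partial>lebesgue)"
    using i1 i2 by (simp add: right_diff_distrib)
  also have "(\<integral>x. tent R x * f (x + v) \<partial>lebesgue) = (\<integral>x. tent R (x - v) * f x \<partial>lebesgue)"
    using lebesgue_integral_translate[of "\<lambda>x. tent R (x - v) * f x" v] t3 f by simp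
  also have "\<dots> - (\<integral>x. tent R x * f x \<partial>lebesgue) = (\<integral>x. (tent R (x - v) - tent R x) * f x \<partial>lebesgue)"
    using i2 i3 by (simp add: left_diff_distrib)
  also have "\<dots> \<le> (\<integral>x. (B * norm v) * indicat_real (cball (0::'a) (R + 2)) x \<partial>lebesgue)"
  proof (rule integral_mono)
    show "integrable lebesgue (\<lambda>x. (tent R (x - v) - tent R x) * f x)"
      using i2 i3 by (simp add: left_diff_distrib)
    show "integrable lebesgue (\<lambda>x::'a. (B * norm v) * indicat_real (cball 0 (R + 2)) x)"
      using lmeasurable_cball[of "0::'a" "R + 2"] by (intro integrable_mult_right) (simp add: fmeasurable_def)
    fix x
    have "(tent R (x - v) - tent R x) * f x \<le> \<bar>tent R (x - v) - tent R x\<bar> * \<bar>f x\<bar>"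
      by (metis abs_ge_self abs_mult)
    also have "\<dots> \<le> norm v * B"
      using tent_lipschitz[of R "x - v" x] B[of x] by (intro mult_mono) auto
    finally show "(tent R (x - v) - tent R x) * f x \<le> (B * norm v) * indicat_real (cball 0 (R + 2)) x"
      using off[of x] by (auto simp: indicator_def not_le mult.commute)
  qed
  also have "\<dots> = B * norm v * measure lebesgue (cball (0::'a) (R + 2))"
    by simp
  finally show "(\<integral>x. tent R x * (f (x + v) - f x) \<partial>lebesgue) \<le> B * norm v * measure lebesgue (cball (0::'a) (R + 2))" .
qed

section \<open>The Hausdorff distance of compact sets\<close>

text \<open>
Any bound on the distances between points of \<open>K \<union> K'\<close> is an upper bound. Boundedness makes the supremum
that defines the Hausdorff distance an upper bound of the differences.
\<close>

lemma bdd_above_infdist_diff: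
  fixes K K' :: "'a::metric_space set"
  assumes "bounded K" "K \<noteq> {}" "bounded K'" "K' \<noteq> {}"
  shows "bdd_above (range (\<lambda>x. \<bar>infdist x K - infdist x K'\<bar>))"
proof -
  have "bounded (K \<union> K')" using assms by simp
  then obtain D where D: "\<And>p q. p \<in> K \<union> K' \<Longrightarrow> q \<in> K \<union> K' \<Longrightarrow> dist p q \<le> D"
    unfolding bounded_two_points by blast
  have le: "infdist x L \<le> infdist x L' + D" if "L \<subseteq> K \<union> K'" "L' \<subseteq> K \<union> K'" "L \<noteq> {}" "L' \<noteq> {}" for x and L L' :: "'a set"
  proof -
    obtain p where p: "p \<in> L" using \<open>L \<noteq> {}\<close> by blast
    have "infdist x L - D \<le> dist x q" if q: "q \<in> L'" for q
    proof -
      have "infdist x L \<le> dist x p" using p by (rule infdist_le)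
      also have "\<dots> \<le> dist x q + dist q p" by (rule dist_triangle)
      also have "dist q p \<le> D" using D p q \<open>L \<subseteq> _\<close> \<open>L' \<subseteq> _\<close> by blast
      finally show ?thesis by simp
    qed
    then have "infdist x L - D \<le> infdist x L'"
      using that by (simp add: infdist_notempty cINF_greatest)
    then show ?thesis by simp
  qed
  have "\<bar>infdist x K - infdist x K'\<bar> \<le> D" for x
    using le[of K K' x] le[of K' K x] assms by auto
  then show ?thesis by (intro bdd_aboveI2)
qed

lemma infdist_diff_le_hausdorff_distance:
  fixes K K' :: "'a::metric_space set"
  assumes "bounded K" "K \<noteq> {}" "bounded K'" "K' \<noteq> {}"
  shows "\<bar>infdist x K - infdist x K'\<bar> \<le> hausdorff_distance K K'"
  unfolding hausdorff_distance_def
  by (intro cSUP_upper bdd_above_infdist_diff assms) simp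

lemma hausdorff_distance_triangle_le:
  fixes K K' L :: "'a::metric_space set"
  assumes "bounded K" "K \<noteq> {}" "bounded K'" "K' \<noteq> {}" "bounded L" "L \<noteq> {}"
  shows "hausdorff_distance K K' \<le> hausdorff_distance K L + hausdorff_distance K' L"
  unfolding hausdorff_distance_def[of K K']
proof (rule cSUP_least)
  fix x
  show "\<bar>infdist x K - infdist x K'\<bar> \<le> hausdorff_distance K L + hausdorff_distance K' L"
    using infdist_diff_le_hausdorff_distance[of K L x] infdist_diff_le_hausdorff_distance[of K' L x] assms
    by linarith
qed simp

lemma hausdorff_distance_nonneg:
  fixes K K' :: "'a::metric_space set"
  assumes "bounded K" "K \<noteq> {}" "bounded K'" "K' \<noteq> {}"
  shows "0 \<le> hausdorff_distance K K'"
  using infdist_diff_le_hausdorff_distance[OF assms, of undefined] by linarith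

lemma hausdorff_distance_eq_0_imp_eq:
  fixes K K' :: "'a::metric_space set"
  assumes "compact K" "K \<noteq> {}" "compact K'" "K' \<noteq> {}" "hausdorff_distance K K' = 0"
  shows "K = K'"
proof -
  have "infdist x K = infdist x K'" for x
    using infdist_diff_le_hausdorff_distance[OF compact_imp_bounded[OF assms(1)] assms(2)
        compact_imp_bounded[OF assms(3)] assms(4), of x] assms(5) by simp
  then have "x \<in> K \<longleftrightarrow> x \<in> K'" for x
    using in_closed_iff_infdist_zero[OF compact_imp_closed[OF assms(1)] assms(2), of x]
      in_closed_iff_infdist_zero[OF compact_imp_closed[OF assms(3)] assms(4), of x] by simp
  then show ?thesis by blast
qed

lemma subset_cball_if_hausdorff_distance_le:
  fixes K K0 :: "'a::euclidean_space set"
  assumes K: "compact K" "K \<noteq> {}" and K0: "compact K0" "K0 \<noteq> {}" "K0 \<subseteq> cball 0 B0"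
    and r: "hausdorff_distance K K0 \<le> r"
  shows "K \<subseteq> cball 0 (B0 + r)"
proof
  fix x assume "x \<in> K"
  then have "infdist x K = 0" by simp
  then have "infdist x K0 \<le> r"
    using infdist_diff_le_hausdorff_distance[OF compact_imp_bounded[OF K(1)] K(2)
        compact_imp_bounded[OF K0(1)] K0(2), of x] r by linarith
  moreover obtain z where z: "z \<in> K0" "infdist x K0 = dist x z"
    using infdist_attains_inf[of K0 x] K0 compact_imp_closed by blast
  ultimately have "dist x z \<le> r" "norm z \<le> B0" using K0 by auto
  then show "x \<in> cball 0 (B0 + r)"
    using norm_triangle_sub[of x z] by (simp add: dist_norm)
qed

section \<open>Hoelder continuity of the projection\<close>

text \<open>
The analogue for coordinates of nearest points of bounding \<open>\<bar>f' - g'\<bar>\<close> for two convex functions with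
\<open>\<bar>f - g\<bar> \<le> \<epsilon>\<close>: the slope \<open>f'(x)\<close> is at most \<open>(f(x + s) - f(x)) / s\<close>, which differs from the same quotient for \<open>g\<close>
by at most \<open>2 \<epsilon> / s\<close>, and that quotient is at most \<open>g'(x + s)\<close>. The increments of both maps are nonnegative
by monotonicity, so their sum bounds the difference from both sides.
\<close>

lemma closest_point_component_diff_le:
  fixes K K' :: "'a::euclidean_space set"
  assumes K: "compact K" "K \<noteq> {}" "K \<subseteq> cball 0 B" and K': "compact K'" "K' \<noteq> {}" "K' \<subseteq> cball 0 B"
    and \<delta>: "\<And>x. \<bar>infdist x K - infdist x K'\<bar> \<le> \<delta>"
    and s: "0 < s" "s \<le> 1" and b: "norm b = 1" and x: "norm x \<le> R"
  shows "\<bar>(closest_point K x - closest_point K' x) \<bullet> b\<bar>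
    \<le> (closest_point K (x + s *\<^sub>R b) \<bullet> b - closest_point K x \<bullet> b)
      + (closest_point K' (x + s *\<^sub>R b) \<bullet> b - closest_point K' x \<bullet> b) + 2 * (R + 1 + B) * \<delta> / s"
proof -
  let ?y = "x + s *\<^sub>R b"
  \<comment> \<open>The distances to \<open>K\<close> and \<open>K\'\<close> are at most \<open>R + 1 + B\<close> at both \<open>x\<close> and its translate.\<close>
  have sq: "\<bar>(infdist z K)\<^sup>2 - (infdist z K')\<^sup>2\<bar> \<le> 2 * (R + 1 + B) * \<delta>" if z: "norm z \<le> R + 1" for z
  proof -
    have bd: "infdist z L \<le> R + 1 + B" if L: "L \<noteq> {}" "L \<subseteq> cball 0 B" for L
    proof -
      obtain p where p: "p \<in> L" using L by blast
      then have "infdist z L \<le> dist z p" by (rule infdist_le)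
      also have "\<dots> \<le> norm z + norm p" by (simp add: dist_norm norm_triangle_ineq4)
      finally show ?thesis using p L z by force
    qed
    have "(infdist z K)\<^sup>2 - (infdist z K')\<^sup>2 = (infdist z K + infdist z K') * (infdist z K - infdist z K')"
      by (simp add: algebra_simps power2_eq_square)
    moreover have "\<bar>infdist z K + infdist z K'\<bar> \<le> 2 * (R + 1 + B)"
      using bd[of K] bd[of K'] K K' infdist_nonneg[of z K] infdist_nonneg[of z K'] by auto
    moreover have "0 \<le> \<delta>" using \<delta>[of z] by linarith
    ultimately show ?thesis
      unfolding abs_mult using \<delta>[of z] by (auto simp: abs_mult intro!: mult_mono)
  qed
  have y: "norm ?y \<le> R + 1"
    using norm_triangle_ineq[of x "s *\<^sub>R b"] x s b by simp
  note near = closest_point_in_nearest_points[OF K(1,2)] closest_point_in_nearest_points[OF K'(1,2)]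
  have sqx: "\<bar>(infdist x K)\<^sup>2 - (infdist x K')\<^sup>2\<bar> \<le> 2 * (R + 1 + B) * \<delta>" by (rule sq) (use x in simp)
  note sqy = sq[OF y]
  have shift: "(p - r) \<bullet> b \<le> 2 * (R + 1 + B) * \<delta> / s"
    if "2 * (s * ((p - r) \<bullet> b)) \<le> 2 * (2 * (R + 1 + B) * \<delta>)" for p r :: 'a
    using that s by (simp add: pos_le_divide_eq mult.commute)
  have 1: "(closest_point K x - closest_point K' ?y) \<bullet> b \<le> 2 * (R + 1 + B) * \<delta> / s"
    by (rule shift) (use nearest_points_inner_le[OF near(1)[of x] near(2)[of ?y]] sqx sqy in simp)
  have 2: "(closest_point K' x - closest_point K ?y) \<bullet> b \<le> 2 * (R + 1 + B) * \<delta> / s"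
    by (rule shift) (use nearest_points_inner_le[OF near(2)[of x] near(1)[of ?y]] sqx sqy in simp)
  have 3: "0 \<le> (closest_point K ?y - closest_point K x) \<bullet> b"
    using nearest_points_monotone[OF near(1)[of x] near(1)[of ?y]] s by (simp add: zero_le_mult_iff)
  have 4: "0 \<le> (closest_point K' ?y - closest_point K' x) \<bullet> b"
    using nearest_points_monotone[OF near(2)[of x] near(2)[of ?y]] s by (simp add: zero_le_mult_iff)
  show ?thesis
    using 1 2 3 4 by (simp add: inner_diff_left abs_le_iff)
qed

text \<open>
Integrating the pointwise bound: each of the two increments contributes \<open>B * s\<close>, and the error in the
distances contributes \<open>\<delta> / s\<close>, up to constants depending on \<open>R\<close> and \<open>B\<close>. The pointwise bound is used on the
support of the cutoff, a ball of radius \<open>R + 1\<close>.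
\<close>

lemma integral_tent_component_diff_le:
  fixes K K' :: "'a::euclidean_space set"
  assumes K: "compact K" "K \<noteq> {}" "K \<subseteq> cball 0 B" and K': "compact K'" "K' \<noteq> {}" "K' \<subseteq> cball 0 B"
    and \<delta>: "\<And>x. \<bar>infdist x K - infdist x K'\<bar> \<le> \<delta>"
    and s: "0 < s" "s \<le> 1" and b: "b \<in> Basis" and R: "0 \<le> R"
  shows "integrable lebesgue (\<lambda>x. tent R x * \<bar>(closest_point K x - closest_point K' x) \<bullet> b\<bar>)" (is ?I)
    and "(\<integral>x. tent R x * \<bar>(closest_point K x - closest_point K' x) \<bullet> b\<bar> \<partial>lebesgue)
      \<le> (2 * B * s + 2 * (R + 2 + B) * (R + 1) * \<delta> / s) * measure lebesgue (cball (0::'a) (R + 2))" (is ?L)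
proof -
  let ?V = "measure lebesgue (cball (0::'a) (R + 2))"
  let ?q = "\<lambda>x. closest_point K x \<bullet> b" and ?q' = "\<lambda>x. closest_point K' x \<bullet> b"
  let ?inc = "\<lambda>q x. tent R x * (q (x + s *\<^sub>R b) - q x :: real)"
  let ?M = "2 * (R + 2 + B) * \<delta> / s"
  have m [measurable]: "closest_point K \<in> borel_measurable lebesgue" "closest_point K' \<in> borel_measurable lebesgue"
    using closest_point_measurable K K' by blast+
  have nb: "norm b = 1" using b by simp
  have bd: "\<bar>?q x\<bar> \<le> B" "\<bar>?q' x\<bar> \<le> B" for x
    using norm_closest_point_le[OF K, of x] norm_closest_point_le[OF K', of x]
      Basis_le_norm[OF b, of "closest_point K x"] Basis_le_norm[OF b, of "closest_point K' x"] by linarith+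
  have sb: "norm (s *\<^sub>R b) = s" using nb s by simp
  have "0 \<le> B" using bd(1)[of 0] by linarith
  have "0 \<le> \<delta>" using \<delta>[of 0] by linarith
  have i: "integrable lebesgue (?inc ?q)" and l: "(\<integral>x. ?inc ?q x \<partial>lebesgue) \<le> B * s * ?V"
    using integral_tent_increment_le[of ?q B R "s *\<^sub>R b"] bd R s sb by auto
  have i': "integrable lebesgue (?inc ?q')" and l': "(\<integral>x. ?inc ?q' x \<partial>lebesgue) \<le> B * s * ?V"
    using integral_tent_increment_le[of ?q' B R "s *\<^sub>R b"] bd R s sb by auto
  note t = integral_tent_le[OF R, where 'a = 'a]
  show I: ?I
  proof (rule integrable_bounded_support[where R = "R + 1" and M = "(R + 1) * (2 * B)"])
    fix x :: 'a
    have "\<bar>?q x - ?q' x\<bar> \<le> 2 * B"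
      using bd[of x] by linarith
    then show "norm (tent R x * \<bar>(closest_point K x - closest_point K' x) \<bullet> b\<bar>) \<le> (R + 1) * (2 * B)"
      using tent_le[OF R, of x] tent_nonneg[of R x] R
      by (auto simp: abs_mult inner_diff_left intro!: mult_mono)
  qed (auto simp: tent_eq_0)
  have "(\<integral>x. tent R x * \<bar>(closest_point K x - closest_point K' x) \<bullet> b\<bar> \<partial>lebesgue)
      \<le> (\<integral>x. (?inc ?q x + ?inc ?q' x) + ?M * tent R x \<partial>lebesgue)"
  proof (rule integral_mono[OF I])
    show "integrable lebesgue (\<lambda>x. (?inc ?q x + ?inc ?q' x) + ?M * tent R x)"
      using i i' t(1) by (intro Bochner_Integration.integrable_add integrable_mult_right)
    fix x :: 'a
    show "tent R x * \<bar>(closest_point K x - closest_point K' x) \<bullet> b\<bar> \<le> (?inc ?q x + ?inc ?q' x) + ?M * tent R x"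
    proof (cases "norm x \<le> R + 1")
      case True
      have "\<bar>(closest_point K x - closest_point K' x) \<bullet> b\<bar>
          \<le> (?q (x + s *\<^sub>R b) - ?q x) + (?q' (x + s *\<^sub>R b) - ?q' x) + ?M"
        using closest_point_component_diff_le[OF K K' \<delta> s nb True] by (simp add: add.assoc)
      from mult_left_mono[OF this tent_nonneg[of R x]] show ?thesis
        by (simp add: algebra_simps)
    next
      case False
      then show ?thesis by (simp add: tent_eq_0)
    qed
  qed
  also have "\<dots> = (\<integral>x. ?inc ?q x \<partial>lebesgue) + (\<integral>x. ?inc ?q' x \<partial>lebesgue) + ?M * integral\<^sup>L lebesgue (tent R :: 'a \<Rightarrow> real)"
    using i i' t(1) by simp
  also have "\<dots> \<le> B * s * ?V + B * s * ?V + ?M * ((R + 1) * ?V)"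
    using l l' t(2) \<open>0 \<le> B\<close> \<open>0 \<le> \<delta>\<close> R s by (intro add_mono mult_left_mono) auto
  also have "\<dots> = (2 * B * s + 2 * (R + 2 + B) * (R + 1) * \<delta> / s) * ?V"
    by (simp add: algebra_simps)
  finally show ?L .
qed

text \<open>
Summing over the coordinates bounds the norm, and the cutoff is at least 1 on \<open>E\<close>. Almost everywhere the
projections agree with the chosen nearest points.
\<close>

lemma L1_norm_on_proj_fun_diff_le:
  fixes K K' E :: "'a::euclidean_space set"
  assumes E: "open E" "E \<subseteq> cball 0 R" and R: "0 \<le> R"
    and K: "compact K" "K \<noteq> {}" "K \<subseteq> cball 0 B" and K': "compact K'" "K' \<noteq> {}" "K' \<subseteq> cball 0 B"
    and \<delta>: "\<And>x. \<bar>infdist x K - infdist x K'\<bar> \<le> \<delta>"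
    and s: "0 < s" "s \<le> 1"
  shows "L1_norm_on E (\<lambda>x. proj_fun K x - proj_fun K' x)
    \<le> DIM('a) * ((2 * B * s + 2 * (R + 2 + B) * (R + 1) * \<delta> / s) * measure lebesgue (cball (0::'a) (R + 2)))"
proof -
  let ?c = "\<lambda>b x. tent R x * \<bar>(closest_point K x - closest_point K' x) \<bullet> b\<bar>"
  note c = integral_tent_component_diff_le[OF K K' \<delta> s _ R]
  have bE: "bounded E" using E bounded_cball bounded_subset by blast
  have "L1_norm_on E (\<lambda>x. proj_fun K x - proj_fun K' x)
      = (\<integral>x. indicator E x *\<^sub>R norm (proj_fun K x - proj_fun K' x) \<partial>lebesgue)"
    by (simp add: L1_norm_on_def set_lebesgue_integral_def)
  also have "\<dots> \<le> (\<integral>x. (\<Sum>b\<in>Basis. ?c b x) \<partial>lebesgue)"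
  proof (rule integral_mono_AE)
    have "(\<lambda>x. proj_fun K x - proj_fun K' x) absolutely_integrable_on E"
      using proj_fun_absolutely_integrable[OF E(1) bE] K K' by (intro set_integral_diff) auto
    then have "(\<lambda>x. norm (proj_fun K x - proj_fun K' x)) absolutely_integrable_on E"
      by (rule absolutely_integrable_norm[unfolded o_def])
    then show "integrable lebesgue (\<lambda>x. indicator E x *\<^sub>R norm (proj_fun K x - proj_fun K' x))"
      by (simp add: set_integrable_def)
    show "integrable lebesgue (\<lambda>x. \<Sum>b\<in>Basis. ?c b x)"
      using c(1) by (intro Bochner_Integration.integrable_sum)
    show "AE x in lebesgue. indicator E x *\<^sub>R norm (proj_fun K x - proj_fun K' x) \<le> (\<Sum>b\<in>Basis. ?c b x)"
      using AE_proj_fun_eq_closest_point[OF K(1)] AE_proj_fun_eq_closest_point[OF K'(1)]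
    proof eventually_elim
      case (elim x)
      show ?case
      proof (cases "x \<in> E")
        case True
        then have "1 \<le> tent R x" using E by (intro tent_ge_1) auto
        then have "\<bar>(closest_point K x - closest_point K' x) \<bullet> b\<bar> \<le> ?c b x" for b
          by (simp add: mult_le_cancel_right1)
        then have "(\<Sum>b\<in>Basis. \<bar>(closest_point K x - closest_point K' x) \<bullet> b\<bar>) \<le> (\<Sum>b\<in>Basis. ?c b x)"
          by (rule sum_mono)
        with norm_le_l1[of "closest_point K x - closest_point K' x"] elim True show ?thesis by simp
      qed (simp add: sum_nonneg tent_nonneg)
    qed
  qed
  also have "\<dots> = (\<Sum>b\<in>Basis. \<integral>x. ?c b x \<partial>lebesgue)"
    using c(1) by (rule Bochner_Integration.integral_sum)
  also have "\<dots> \<le> DIM('a) * ((2 * B * s + 2 * (R + 2 + B) * (R + 1) * \<delta> / s) * measure lebesgue (cball (0::'a) (R + 2)))"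
    using c(2) by (rule sum_bounded_above)
  finally show ?thesis .
qed

text \<open>
The choice \<open>s = sqrt \<delta>\<close> balances the terms \<open>s\<close> and \<open>\<delta> / s\<close>. When \<open>\<delta> = 0\<close> no positive step \<open>s\<close> is available,
but then the two compact sets are equal.
\<close>

lemma L1_norm_on_proj_fun_diff_le_sqrt:
  fixes K K' E :: "'a::euclidean_space set"
  assumes E: "open E" "E \<subseteq> cball 0 R" and R: "0 \<le> R"
    and K: "compact K" "K \<noteq> {}" "K \<subseteq> cball 0 B" and K': "compact K'" "K' \<noteq> {}" "K' \<subseteq> cball 0 B"
    and d: "hausdorff_distance K K' \<le> 1"
  shows "L1_norm_on E (\<lambda>x. proj_fun K x - proj_fun K' x)
    \<le> DIM('a) * ((2 * B + 2 * (R + 2 + B) * (R + 1)) * measure lebesgue (cball (0::'a) (R + 2)))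
        * sqrt (hausdorff_distance K K')"
proof (cases "hausdorff_distance K K' = 0")
  case True
  then have "K = K'" using hausdorff_distance_eq_0_imp_eq K K' by blast
  with True show ?thesis by (simp add: L1_norm_on_def)
next
  case False
  let ?\<delta> = "hausdorff_distance K K'"
  note bd = compact_imp_bounded[OF K(1)] K(2) compact_imp_bounded[OF K'(1)] K'(2)
  have pos: "0 < ?\<delta>" using False hausdorff_distance_nonneg[OF bd] by simp
  have "?\<delta> / sqrt ?\<delta> = sqrt ?\<delta>" using pos by (simp add: real_div_sqrt)
  then have q: "c * ?\<delta> / sqrt ?\<delta> = c * sqrt ?\<delta>" for c
    by (metis times_divide_eq_right)
  show ?thesis
    using L1_norm_on_proj_fun_diff_le[OF E R K K' infdist_diff_le_hausdorff_distance[OF bd], of "sqrt ?\<delta>"] pos d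
    unfolding q by (simp add: algebra_simps)
qed

theorem theoremB:
  fixes E :: "'a::euclidean_space set"
  assumes "open E" and "bounded E"
  shows "(\<forall>K :: 'a set. compact K \<and> K \<noteq> {} \<longrightarrow> proj_fun K absolutely_integrable_on E) \<and>
    (\<forall>(h :: real) (K0 :: 'a set).
      0 < h \<and> h < 1 / (4 * real DIM('a) - 2) \<and> compact K0 \<and> K0 \<noteq> {} \<longrightarrow>
      (\<exists>r > 0. \<exists>C \<ge> 0. \<forall>K K'.
        compact K \<and> K \<noteq> {} \<and> compact K' \<and> K' \<noteq> {} \<and>
        hausdorff_distance K K0 \<le> r \<and> hausdorff_distance K' K0 \<le> r \<longrightarrow>
        L1_norm_on E (\<lambda>x. proj_fun K x - proj_fun K' x)
          \<le> C * hausdorff_distance K K' powr h))"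
proof (intro conjI allI impI; elim conjE)
  fix K :: "'a set" assume "compact K" "K \<noteq> {}"
  then show "proj_fun K absolutely_integrable_on E"
    using assms by (intro proj_fun_absolutely_integrable)
next
  fix h :: real and K0 :: "'a set"
  assume h: "0 < h" "h < 1 / (4 * real DIM('a) - 2)" and K0: "compact K0" "K0 \<noteq> {}"
  \<comment> \<open>The exponents in question are all below 1/2, so for distances at most 1 the square root bound is stronger.\<close>
  have "1 \<le> real DIM('a)" using DIM_positive[where 'a = 'a] by linarith
  then have "1 / (4 * real DIM('a) - 2) \<le> 1 / 2" by (intro divide_left_mono mult_pos_pos) linarith+
  with h have h2: "h \<le> 1 / 2" by linarith
  obtain R where R: "0 < R" "E \<subseteq> cball 0 R"
    using bounded_subset_ballD[OF assms(2), of 0] ball_subset_cball by (meson subset_trans)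
  obtain B0 where B0: "0 < B0" "K0 \<subseteq> cball 0 B0"
    using bounded_subset_ballD[OF compact_imp_bounded[OF K0(1)], of 0] ball_subset_cball by (meson subset_trans)
  \<comment> \<open>With \<open>r = 1/2\<close>, both sets lie in one ball and their mutual distance is at most 1.\<close>
  define B where "B = B0 + 1 / 2"
  define C where "C = DIM('a) * ((2 * B + 2 * (R + 2 + B) * (R + 1)) * measure lebesgue (cball (0::'a) (R + 2)))"
  have C: "0 \<le> C" using R B0 by (simp add: C_def B_def)
  have "L1_norm_on E (\<lambda>x. proj_fun K x - proj_fun K' x) \<le> C * hausdorff_distance K K' powr h"
    if K: "compact K" "K \<noteq> {}" and K': "compact K'" "K' \<noteq> {}"
      and d: "hausdorff_distance K K0 \<le> 1 / 2" "hausdorff_distance K' K0 \<le> 1 / 2" for K K' :: "'a set"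
  proof -
    let ?\<delta> = "hausdorff_distance K K'"
    note bd = compact_imp_bounded[OF K(1)] K(2) compact_imp_bounded[OF K'(1)] K'(2)
    have d0: "0 \<le> ?\<delta>" using bd by (rule hausdorff_distance_nonneg)
    have d1: "?\<delta> \<le> 1"
      using hausdorff_distance_triangle_le[OF bd compact_imp_bounded[OF K0(1)] K0(2)] d by linarith
    have "K \<subseteq> cball 0 B" "K' \<subseteq> cball 0 B"
      unfolding B_def
      using subset_cball_if_hausdorff_distance_le[OF K K0 B0(2) d(1)]
        subset_cball_if_hausdorff_distance_le[OF K' K0 B0(2) d(2)] .
    then have "L1_norm_on E (\<lambda>x. proj_fun K x - proj_fun K' x) \<le> C * sqrt ?\<delta>"
      unfolding C_def using assms R K K' d1 by (intro L1_norm_on_proj_fun_diff_le_sqrt) auto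
    also have "sqrt ?\<delta> \<le> ?\<delta> powr h"
      using powr_mono'[OF h2 d0 d1] d0 by (simp add: powr_half_sqrt)
    finally show ?thesis using C by (simp add: mult_left_mono)
  qed
  then show "\<exists>r > 0. \<exists>C \<ge> 0. \<forall>K K'.
        compact K \<and> K \<noteq> {} \<and> compact K' \<and> K' \<noteq> {} \<and>
        hausdorff_distance K K0 \<le> r \<and> hausdorff_distance K' K0 \<le> r \<longrightarrow>
        L1_norm_on E (\<lambda>x. proj_fun K x - proj_fun K' x)
          \<le> C * hausdorff_distance K K' powr h"
    using C by (intro exI[of _ "1 / 2"] exI[of _ C] conjI) auto
qed

end
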